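(* The following statements are equivalent: (1) The Continuum Hypothesis. (2) There is a weak selection $f$ on $\mathbb{R}$ such that $|(\leftarrow, r)_f|\leq \omega$ for each $r\in\mathbb{R}$. (3) There is a weak selection $f$ on $\mathbb{R}$ such that $|(r,\rightarrow)_f|\leq \omega$ for each $r\in\mathbb{R}$. (4) There is a weak selection $f$ on $\mathbb{R}$ such that the $f$-interval $(r,s]_f$ is countable for all $r,s\in\mathbb{R}$. (5) There is a weak selection $f$ on $\mathbb{R}$ and a subset $D\subseteq\mathbb{R}$ such that $|D|=\mathfrak{c}$ and $|(r,s]_f\cap D|\leq\omega$ for all $r,s\in\mathbb{R}$. (6) There is a weak selection $f$ on $\mathbb{R}$ such that $\lambda_f=\mu$.
   Context: A weak selection on $\mathbb{R}$ is a function $f:[\mathbb{R}]^2\to\mathbb{R}$ with $f(F)\in F$ for every two-element set $F\subseteq\mathbb{R}$. For distinct $x,y$ write $x<_f y$ if $f(\{x,y\})=x$, and $x\leq_f y$ if $x<_f y$ or $x=y$ (this relation need not be transitive). For $r,s\in\mathbb{R}$: $(\leftarrow,r)_f=\{x\in\mathbb{R}: x<_f r\}$, $(r,\rightarrow)_f=\{x\in\mathbb{R}: r<_f x\}$, $(r,s]_f=\{x\in\mathbb{R}: r<_f x\leq_f s\}$ (it is not required that $r<_f s$). For $A\subseteq\mathbb{R}$, $\lambda_f(A)=\inf\{\sum_{n\in\mathbb{N}}|s_n-r_n| : A\subseteq\bigcup_{n\in\mathbb{N}}(r_n,s_n]_f\}$ if $A$ can be covered by countably many intervals $(r,s]_f$,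 and $\lambda_f(A)=+\infty$ otherwise; $\lambda_f$ is an outer measure. $\mu$ is defined by $\mu(A)=0$ if $|A|\leq\omega$ and $\mu(A)=\infty$ otherwise, for $A\subseteq\mathbb{R}$. $\mathfrak{c}$ is the cardinality of $\mathbb{R}$. *)

theory Defs
  imports Complex_Main "HOL-Library.Countable_Set" "HOL-Library.Extended_Nonnegative_Real"
begin

unbundle cardinal_syntax

text \<open>
  A weak selection is a function on the two-element sets of reals. It is encoded as a total function
  on all sets of reals; its values on sets that do not have exactly two elements are
  unconstrained and are never used below.
\<close>

definition weak_selection :: "(real set \<Rightarrow> real) \<Rightarrow> bool" where
  "weak_selection f \<longleftrightarrow> (\<forall>F. card F = 2 \<longrightarrow> f F \<in> F)"

definition sel_less :: "(real set \<Rightarrow> real) \<Rightarrow> real \<Rightarrow> real \<Rightarrow> bool" where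
  "sel_less f x y \<longleftrightarrow> x \<noteq> y \<and> f {x, y} = x"

definition sel_le :: "(real set \<Rightarrow> real) \<Rightarrow> real \<Rightarrow> real \<Rightarrow> bool" where
  "sel_le f x y \<longleftrightarrow> sel_less f x y \<or> x = y"

definition sel_lessThan :: "(real set \<Rightarrow> real) \<Rightarrow> real \<Rightarrow> real set" where
  "sel_lessThan f r = {x. sel_less f x r}"

definition sel_greaterThan :: "(real set \<Rightarrow> real) \<Rightarrow> real \<Rightarrow> real set" where
  "sel_greaterThan f r = {x. sel_less f r x}"

definition sel_greaterThanAtMost :: "(real set \<Rightarrow> real) \<Rightarrow> real \<Rightarrow> real \<Rightarrow> real set" where
  "sel_greaterThanAtMost f r s = {x. sel_less f r x \<and> sel_le f x s}"

text \<open>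
  In \<^typ>\<open>ennreal\<close> the infimum of the empty set is \<open>\<infinity>\<close>, which is the prescribed value for a set
  without a countable cover by intervals. The interval from \<open>r\<close> to \<open>r\<close> is empty, so
  sequences of intervals also account for finite covers.
\<close>

definition sel_outer :: "(real set \<Rightarrow> real) \<Rightarrow> real set \<Rightarrow> ennreal" where
  "sel_outer f A =
     Inf {\<Sum>n. ennreal \<bar>s n - r n\<bar> | r s :: nat \<Rightarrow> real. A \<subseteq> (\<Union>n. sel_greaterThanAtMost f (r n) (s n))}"

definition countability_measure :: "real set \<Rightarrow> ennreal" where
  "countability_measure A = (if countable A then 0 else \<infinity>)"

text \<open>The cardinality of the continuum equals the successor cardinal of \<open>\<omega>\<close>.\<close>

definition Continuum_Hypothesis :: bool where
  "Continuum_Hypothesis \<longleftrightarrow> |UNIV :: real set| =o cardSuc natLeq"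

end

theory Submission
  imports Defs "HOL-Library.Countable_Set_Type" "HOL-Analysis.Continuum_Not_Denumerable"
begin

text \<open>
  A weak selection is the same thing as a tournament on the reals: for distinct \<open>x\<close> and \<open>y\<close>, exactly
  one of \<open>x <\<^sub>f y\<close> and \<open>y <\<^sub>f x\<close> holds.  The theorem rests on one combinatorial fact and one
  construction.

  The fact (\<open>card_of_countable_predecessors\<close>): a tournament in which every vertex has only countably
  many predecessors has at most \<open>\<aleph>\<^sub>1\<close> vertices.  If there were more, fix a set \<open>A\<close> of \<open>\<aleph>\<^sub>1\<close> vertices;
  the predecessors of its members fill up only \<open>\<aleph>\<^sub>1\<close> vertices, so some vertex outside of \<open>A\<close> precedes
  no member of \<open>A\<close>.  All of \<open>A\<close> then precedes it, and \<open>A\<close> would be countable.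

  Among the conditions on \<open>f\<close> other than that on \<open>\<lambda>\<^sub>f\<close>, the weakest asks only that \<open>(r, s]\<^sub>f \<inter> D\<close> be
  countable for all \<open>r\<close> and \<open>s\<close> and some \<open>D\<close> of size continuum.  It gives the Continuum Hypothesis
  (\<open>CH_if_countable_intervals_on\<close>): splitting \<open>D\<close> at any real \<open>r\<close> yields the points before \<open>r\<close>, those
  after \<open>r\<close>, and possibly \<open>r\<close>.  Among the points after \<open>r\<close>, the predecessors of \<open>s\<close> lie in \<open>(r, s]\<^sub>f\<close>,
  so they are countably many and the fact applies.  Among those before \<open>r\<close>, the successors of \<open>s\<close> lie
  in \<open>(s, r]\<^sub>f\<close>, and the fact applies to the reversed tournament.  So \<open>D\<close> has at most \<open>\<aleph>\<^sub>1\<close> elements.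
  If \<open>\<lambda>\<^sub>f = \<mu>\<close>, then all intervals are countable, since \<open>\<lambda>\<^sub>f((r, s]\<^sub>f) \<le> \<bar>s - r\<bar>\<close> is finite and \<open>\<mu>\<close> is
  finite on countable sets only.

  The construction: under the Continuum Hypothesis the reals have a well-order all of whose proper
  initial segments are countable.  Choosing the minimum of each pair makes all \<open>(\<leftarrow>, r)\<^sub>f\<close> countable,
  choosing the maximum does so for all \<open>(r, \<rightarrow>)\<^sub>f\<close>, and either makes all intervals countable, so that
  \<open>\<lambda>\<^sub>f\<close> is infinite on uncountable sets.  For \<open>\<lambda>\<^sub>f = \<mu>\<close>, countable sets must also get measure zero.
  This holds as soon as every \<open>x\<close> has predecessors at arbitrarily small distance, because
  \<open>x \<in> (q, x]\<^sub>f\<close> for every predecessor \<open>q\<close>.  The well-order itself fails here: its least element has no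
  predecessor.  The remedy is to place the rationals, in their usual order, before all irrationals
  (\<open>CH_dense_predecessors\<close>).
\<close>

section \<open>Tournaments with countable sets of predecessors\<close>

lemma card_of_le_cardSuc_natLeq_Un:
  assumes "|A| \<le>o cardSuc natLeq" and "|B| \<le>o cardSuc natLeq"
  shows "|A \<union> B| \<le>o cardSuc natLeq"
proof (rule card_of_Un_ordLeq_infinite_Field)
  show "infinite (Field (cardSuc natLeq))"
    using cardSuc_finite[OF natLeq_Card_order] by (simp add: Field_natLeq)
  show "Card_order (cardSuc natLeq)"
    by (rule cardSuc_Card_order[OF natLeq_Card_order])
qed (use assms in simp_all)

lemma countable_imp_card_of_le_cardSuc: "countable A \<Longrightarrow> |A| \<le>o cardSuc natLeq"
  using cardSuc_ordLeq[OF natLeq_Card_order] ordLeq_transitive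
  unfolding countable_card_le_natLeq by blast

lemma uncountable_iff_cardSuc_le: "uncountable A \<longleftrightarrow> cardSuc natLeq \<le>o |A|"
proof -
  have "uncountable A \<longleftrightarrow> natLeq <o |A|"
    unfolding countable_card_le_natLeq
    using not_ordLeq_iff_ordLess[OF natLeq_Well_order card_of_Well_order] by blast
  also have "\<dots> \<longleftrightarrow> cardSuc natLeq \<le>o |A|"
    by (rule cardSuc_ordLess_ordLeq[OF natLeq_Card_order card_of_Card_order])
  finally show ?thesis .
qed

text \<open>
  The bound \<open>\<aleph>\<^sub>1\<close> comes from a closing-off step: \<open>\<aleph>\<^sub>1\<close> vertices together with all their predecessors are
  still only \<open>\<aleph>\<^sub>1\<close> many, and a vertex outside of this set would have \<open>\<aleph>\<^sub>1\<close> predecessors.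
\<close>

lemma card_of_countable_predecessors:
  assumes total: "\<And>x y. x \<in> X \<Longrightarrow> y \<in> X \<Longrightarrow> x \<noteq> y \<Longrightarrow> P x y \<or> P y x"
    and pred: "\<And>y. y \<in> X \<Longrightarrow> countable {x \<in> X. P x y}"
  shows "|X| \<le>o cardSuc natLeq"
proof (rule ccontr)
  let ?\<omega>1 = "cardSuc natLeq"
  have co: "Card_order ?\<omega>1"
    by (rule cardSuc_Card_order[OF natLeq_Card_order])
  assume "\<not> |X| \<le>o ?\<omega>1"
  then have big: "?\<omega>1 <o |X|"
    using not_ordLeq_iff_ordLess[OF card_order_on_well_order_on[OF co] card_of_Well_order] by blast
  then have "|Field ?\<omega>1| \<le>o |X|"
    using co by (meson card_of_Field_ordIso ordIso_ordLeq_trans ordLess_imp_ordLeq)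
  then obtain h where h: "inj_on h (Field ?\<omega>1)" "h ` Field ?\<omega>1 \<subseteq> X"
    by (meson card_of_ordLeq)
  define A where "A = h ` Field ?\<omega>1"
  have "A \<subseteq> X"
    using h by (simp add: A_def)
  have "|Field ?\<omega>1| =o |A|"
    unfolding A_def using card_of_ordIsoI[OF inj_on_imp_bij_betw[OF h(1)]] .
  then have cardA: "|A| =o ?\<omega>1"
    using card_of_Field_ordIso[OF co] by (meson ordIso_symmetric ordIso_transitive)
  have uncA: "uncountable A"
    using cardA by (simp add: uncountable_iff_cardSuc_le ordIso_iff_ordLeq)
  have infA: "infinite A"
    using uncA countable_finite by blast
  define B where "B = (\<Union>y\<in>A. insert y {x \<in> X. P x y})"
  have "|B| \<le>o |A|"
    unfolding B_def
  proof (rule card_of_UNION_ordLeq_infinite[OF infA ordLeq_refl[OF card_of_Card_order]], intro ballI)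
    fix y assume "y \<in> A"
    then have "countable (insert y {x \<in> X. P x y})"
      using pred \<open>A \<subseteq> X\<close> by auto
    from countable_imp_card_of_le_cardSuc[OF this]
    show "|insert y {x \<in> X. P x y}| \<le>o |A|"
      using cardA by (meson ordIso_symmetric ordLeq_ordIso_trans)
  qed
  then have "|B| <o |X|"
    using cardA big by (meson ordLeq_ordIso_trans ordLeq_ordLess_trans)
  then have "\<not> X \<subseteq> B"
    using card_of_mono1 not_ordLess_ordLeq by blast
  then obtain x where x: "x \<in> X" "x \<notin> B"
    by blast
  have "A \<subseteq> {a \<in> X. P a x}"
  proof
    fix a assume "a \<in> A"
    then have "a \<in> X" "a \<noteq> x" "\<not> P x a"
      using x \<open>A \<subseteq> X\<close> by (auto simp: B_def)
    then show "a \<in> {a \<in> X. P a x}"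
      using total x by blast
  qed
  then show False
    using uncA pred[OF x(1)] countable_subset by blast
qed

section \<open>Countable intervals imply the Continuum Hypothesis\<close>

lemma sel_less_total:
  assumes "weak_selection f" "x \<noteq> y"
  shows "sel_less f x y \<or> sel_less f y x"
  using assms unfolding weak_selection_def sel_less_def
  by (metis card_2_iff insertE insert_commute singletonD)

text \<open>
  An interval bounds predecessors only together with a lower end point, and successors only together
  with an upper one.  Splitting \<open>D\<close> at \<open>0\<close>, which could be any real, supplies such an end point to
  each part.
\<close>

lemma CH_if_countable_intervals_on:
  assumes f: "weak_selection f" and D: "|D| =o |UNIV :: real set|"
    and int: "\<And>r s. countable (sel_greaterThanAtMost f r s \<inter> D)"
  shows Continuum_Hypothesis
proof -
  have total: "\<And>x y. x \<noteq> y \<Longrightarrow> sel_less f x y \<or> sel_less f y x"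
    using sel_less_total[OF f] .
  let ?above = "D \<inter> sel_greaterThan f 0" and ?below = "D \<inter> sel_lessThan f 0"
  have "|?above| \<le>o cardSuc natLeq"
  proof (rule card_of_countable_predecessors[where P = "sel_less f"])
    show "countable {x \<in> ?above. sel_less f x s}" for s
      by (rule countable_subset[OF _ int[of 0 s]])
         (auto simp: sel_greaterThan_def sel_greaterThanAtMost_def sel_le_def)
  qed (use total in blast)
  moreover have "|?below| \<le>o cardSuc natLeq"
  proof (rule card_of_countable_predecessors[where P = "\<lambda>x y. sel_less f y x"])
    show "countable {x \<in> ?below. sel_less f s x}" for s
      by (rule countable_subset[OF _ int[of s 0]])
         (auto simp: sel_lessThan_def sel_greaterThanAtMost_def sel_le_def)
  qed (use total in blast)
  moreover have "|{0 :: real}| \<le>o cardSuc natLeq"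
    by (simp add: countable_imp_card_of_le_cardSuc)
  ultimately have "|?above \<union> (?below \<union> {0})| \<le>o cardSuc natLeq"
    by (intro card_of_le_cardSuc_natLeq_Un)
  moreover have "D \<subseteq> ?above \<union> (?below \<union> {0})"
    using total[of _ 0] by (auto simp: sel_greaterThan_def sel_lessThan_def)
  ultimately have "|D| \<le>o cardSuc natLeq"
    using card_of_mono1 ordLeq_transitive by blast
  then have "|UNIV :: real set| \<le>o cardSuc natLeq"
    using D by (meson ordIso_ordLeq_trans ordIso_symmetric)
  moreover have "cardSuc natLeq \<le>o |UNIV :: real set|"
    using uncountable_UNIV_real by (simp add: uncountable_iff_cardSuc_le)
  ultimately show ?thesis
    by (simp add: Continuum_Hypothesis_def ordIso_iff_ordLeq)
qed

lemma CH_if_countable_intervals: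
  assumes "weak_selection f" "\<And>r s. countable (sel_greaterThanAtMost f r s)"
  shows Continuum_Hypothesis
  by (rule CH_if_countable_intervals_on[OF assms(1), of UNIV])
     (use assms(2) card_of_refl in simp_all)

section \<open>The outer measure of intervals and of countable sets\<close>

lemma sel_outer_interval_le: "sel_outer f (sel_greaterThanAtMost f r s) \<le> ennreal \<bar>s - r\<bar>"
proof -
  \<comment> \<open>The cover by the interval itself, padded with the empty intervals from \<open>r\<close> to \<open>r\<close>.\<close>
  let ?s = "\<lambda>n::nat. if n = 0 then s else r"
  have "(\<Sum>n. ennreal \<bar>?s n - r\<bar>) = ennreal \<bar>s - r\<bar>"
    by (subst suminf_finite[of "{0}"]) auto
  moreover have "sel_greaterThanAtMost f r s \<subseteq> (\<Union>n. sel_greaterThanAtMost f r (?s n))"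
    by (auto intro: exI[of _ 0])
  ultimately have "\<exists>r' s'. ennreal \<bar>s - r\<bar> = (\<Sum>n::nat. ennreal \<bar>s' n - r' n\<bar>)
      \<and> sel_greaterThanAtMost f r s \<subseteq> (\<Union>n. sel_greaterThanAtMost f (r' n) (s' n))"
    by (intro exI[of _ "\<lambda>_. r", OF exI[of _ ?s]] conjI) simp_all
  then show ?thesis
    unfolding sel_outer_def by (intro Inf_lower CollectI)
qed

text \<open>
  The \<open>n\<close>-th point \<open>a\<close> of the set is covered by the interval from a predecessor at distance less than
  \<open>e / 2^(n+1)\<close> to \<open>a\<close>.
\<close>

lemma sel_outer_countable_eq_0:
  assumes "countable A"
    and near: "\<And>x e. e > 0 \<Longrightarrow> \<exists>r. sel_less f r x \<and> \<bar>x - r\<bar> < e"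
  shows "sel_outer f A = 0"
proof -
  \<comment> \<open>If \<open>A\<close> is empty, then \<open>a\<close> is some constant sequence; \<open>A \<subseteq> range a\<close> holds all the same.\<close>
  define a where "a = from_nat_into A"
  have A: "A \<subseteq> range a"
    using assms(1) by (metis a_def empty_subsetI range_from_nat_into subset_refl)
  have "sel_outer f A \<le> ennreal e" if e: "e > 0" for e
  proof -
    have "\<forall>n. \<exists>r. sel_less f r (a n) \<and> \<bar>a n - r\<bar> < e * (1/2) ^ Suc n"
      using e by (intro allI near) simp
    then obtain r where r: "\<And>n. sel_less f (r n) (a n)" "\<And>n. \<bar>a n - r n\<bar> < e * (1/2) ^ Suc n"
      by metis
    have "A \<subseteq> (\<Union>n. sel_greaterThanAtMost f (r n) (a n))"
      using A r(1) by (auto simp: sel_greaterThanAtMost_def sel_le_def)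
    then have "sel_outer f A \<le> (\<Sum>n. ennreal \<bar>a n - r n\<bar>)"
      unfolding sel_outer_def by (intro Inf_lower) auto
    also have "\<dots> \<le> (\<Sum>n. ennreal (e * (1/2) ^ Suc n))"
      using r(2) by (intro suminf_le summableI ennreal_leI less_imp_le)
    also have "\<dots> = ennreal e"
      using sums_mult[OF power_half_series, of e] e
      by (intro suminf_ennreal_eq) auto
    finally show ?thesis .
  qed
  then have "sel_outer f A \<le> 0 + ennreal e" if "e > 0" for e
    using that by simp
  then have "sel_outer f A \<le> 0"
    by (rule ennreal_le_epsilon)
  then show ?thesis by simp
qed

lemma sel_outer_eq_infinity:
  assumes "uncountable A" and "\<And>r s. countable (sel_greaterThanAtMost f r s)"
  shows "sel_outer f A = \<infinity>"
proof -
  have "\<not> A \<subseteq> (\<Union>n. sel_greaterThanAtMost f (r n) (s n))" for r s :: "nat \<Rightarrow> real"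
    using assms by (meson countable_UN countable_subset uncountable_def countableI_type)
  then show ?thesis
    by (simp add: sel_outer_def)
qed

lemma CH_if_sel_outer_eq_countability_measure:
  assumes f: "weak_selection f" and eq: "sel_outer f = countability_measure"
  shows Continuum_Hypothesis
proof (rule CH_if_countable_intervals[OF f])
  fix r s
  have "countability_measure (sel_greaterThanAtMost f r s) < \<infinity>"
    using sel_outer_interval_le[of f r s] eq by (metis ennreal_less_top infinity_ennreal_def le_less_trans)
  then show "countable (sel_greaterThanAtMost f r s)"
    by (auto simp: countability_measure_def split: if_splits)
qed

section \<open>Weak selections under the Continuum Hypothesis\<close>

text \<open>
  From here on it suffices to construct relations: the selected point of \<open>{x, y}\<close> is the one that
  precedes the other.
\<close>

lemma weak_selection_of_tournament:
  fixes P :: "real \<Rightarrow> real \<Rightarrow> bool"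
  assumes irrefl: "\<And>x. \<not> P x x" and total: "\<And>x y. x \<noteq> y \<Longrightarrow> P x y \<longleftrightarrow> \<not> P y x"
  obtains f where "weak_selection f" "sel_less f = P"
proof
  define f where "f F = (SOME x. x \<in> F \<and> (\<forall>y\<in>F. y \<noteq> x \<longrightarrow> P x y))" for F
  have pair: "f {x, y} = x" if "P x y" for x y
  proof -
    have "\<not> P y x"
      using that irrefl total by metis
    then show ?thesis
      unfolding f_def using that by (intro some_equality) auto
  qed
  have pair': "f {y, x} = x" if "P x y" for x y
    using pair[OF that] by (simp add: insert_commute)
  show "weak_selection f"
    unfolding weak_selection_def
  proof (intro allI impI)
    fix F :: "real set" assume "card F = 2"
    then obtain x y where "F = {x, y}" "x \<noteq> y"
      by (meson card_2_iff)
    then show "f F \<in> F"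
      using total[of x y] pair[of x y] pair'[of y x] by (metis insertCI)
  qed
  show "sel_less f = P"
  proof (intro ext)
    fix x y
    show "sel_less f x y = P x y"
      unfolding sel_less_def using irrefl[of x] total[of x y] pair[of x y] pair'[of y x] by metis
  qed
qed

lemma CH_well_order:
  assumes Continuum_Hypothesis
  obtains W :: "real \<Rightarrow> real \<Rightarrow> bool" where
    "\<And>x. \<not> W x x" "\<And>x y. x \<noteq> y \<Longrightarrow> W x y \<longleftrightarrow> \<not> W y x" "\<And>y. countable {x. W x y}"
proof -
  \<comment> \<open>A cardinal order: each of its proper initial segments has smaller cardinality.\<close>
  let ?R = "|UNIV :: real set|"
  define W where "W x y \<longleftrightarrow> x \<in> underS ?R y" for x y
  have "linear_order_on UNIV ?R"
    using card_of_well_order_on well_order_on_def by blast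
  then have lin: "total_on UNIV ?R" "antisym ?R"
    by (auto simp: linear_order_on_def partial_order_on_def)
  have "countable {x. W x y}" for y
  proof -
    have "|underS ?R y| <o ?R"
      by (rule card_of_underS[OF card_of_Card_order]) (simp add: Field_card_of)
    then have "|underS ?R y| <o cardSuc natLeq"
      using assms unfolding Continuum_Hypothesis_def by (rule ordLess_ordIso_trans)
    then have "countable (underS ?R y)"
      using uncountable_iff_cardSuc_le not_ordLess_ordLeq by blast
    then show ?thesis
      by (simp add: W_def)
  qed
  moreover have "\<not> W x x" for x
    by (simp add: W_def underS_def)
  moreover have "W x y \<longleftrightarrow> \<not> W y x" if "x \<noteq> y" for x y
    using that lin by (auto simp: W_def underS_def total_on_def antisym_def)
  ultimately show ?thesis
    by (rule that[rotated 2])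
qed

text \<open>
  The rationals are put, in their usual order, before the well-ordered irrationals.  Every rational
  \<open>q < x\<close> then precedes \<open>x\<close>, whether or not \<open>x\<close> is rational.  Being countable, the
  rationals add only countably many predecessors.
\<close>

lemma CH_dense_predecessors:
  assumes Continuum_Hypothesis
  obtains P :: "real \<Rightarrow> real \<Rightarrow> bool" where
    "\<And>x. \<not> P x x" "\<And>x y. x \<noteq> y \<Longrightarrow> P x y \<longleftrightarrow> \<not> P y x" "\<And>y. countable {x. P x y}"
    "\<And>x e. e > 0 \<Longrightarrow> \<exists>q. P q x \<and> \<bar>x - q\<bar> < e"
proof -
  obtain W :: "real \<Rightarrow> real \<Rightarrow> bool" where W: "\<And>x. \<not> W x x"
    "\<And>x y. x \<noteq> y \<Longrightarrow> W x y \<longleftrightarrow> \<not> W y x" "\<And>y. countable {x. W x y}"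
    by (rule CH_well_order[OF assms]) (rule that)
  define P where "P x y \<longleftrightarrow> (if y \<in> \<rat> then x \<in> \<rat> \<and> x < y else x \<in> \<rat> \<or> W x y)" for x y
  have "\<not> P x x" for x
    using W(1) by (simp add: P_def)
  moreover have "P x y \<longleftrightarrow> \<not> P y x" if "x \<noteq> y" for x y
    using W(2)[OF that] that by (auto simp: P_def)
  moreover have "countable {x. P x y}" for y
  proof (rule countable_subset)
    show "{x. P x y} \<subseteq> \<rat> \<union> {x. W x y}"
      by (auto simp: P_def split: if_splits)
    show "countable (\<rat> \<union> {x. W x y})"
      using countable_rat W(3) by blast
  qed
  moreover have "\<exists>q. P q x \<and> \<bar>x - q\<bar> < e" if "e > 0" for x e
  proof -
    obtain q where "q \<in> \<rat>" "x - e < q" "q < x"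
      using Rats_dense_in_real[of "x - e" x] \<open>e > 0\<close> by auto
    then show ?thesis
      by (auto simp: P_def intro!: exI[of _ q])
  qed
  ultimately show ?thesis
    by (rule that)
qed

lemma sel_greaterThanAtMost_subset_lessThan:
  "sel_greaterThanAtMost f r s \<subseteq> insert s (sel_lessThan f s)"
  by (auto simp: sel_greaterThanAtMost_def sel_lessThan_def sel_le_def)

lemma sel_greaterThanAtMost_subset_greaterThan:
  "sel_greaterThanAtMost f r s \<subseteq> sel_greaterThan f r"
  by (auto simp: sel_greaterThanAtMost_def sel_greaterThan_def)

lemma countable_intervals_if_countable_lessThan:
  "(\<And>r. countable (sel_lessThan f r)) \<Longrightarrow> countable (sel_greaterThanAtMost f r s)"
  using sel_greaterThanAtMost_subset_lessThan by (meson countable_insert countable_subset)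

lemma CH_weak_selection:
  assumes Continuum_Hypothesis
  obtains f where "weak_selection f" "\<And>r. countable (sel_lessThan f r)"
    "sel_outer f = countability_measure"
proof -
  obtain P :: "real \<Rightarrow> real \<Rightarrow> bool" where P: "\<And>x. \<not> P x x"
    "\<And>x y. x \<noteq> y \<Longrightarrow> P x y \<longleftrightarrow> \<not> P y x" "\<And>y. countable {x. P x y}"
    "\<And>x e. e > 0 \<Longrightarrow> \<exists>q. P q x \<and> \<bar>x - q\<bar> < e"
    by (rule CH_dense_predecessors[OF assms]) (rule that)
  obtain f where f: "weak_selection f" "sel_less f = P"
    by (rule weak_selection_of_tournament[OF P(1,2)])
  have less: "countable (sel_lessThan f r)" for r
    using P(3) by (simp add: sel_lessThan_def f(2))
  have "sel_outer f = countability_measure"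
  proof
    fix A
    show "sel_outer f A = countability_measure A"
    proof (cases "countable A")
      case True
      have "sel_outer f A = 0"
        by (rule sel_outer_countable_eq_0[OF True]) (use P(4) f(2) in simp)
      then show ?thesis
        using True by (simp add: countability_measure_def)
    next
      case False
      then show ?thesis
        using sel_outer_eq_infinity[OF False countable_intervals_if_countable_lessThan[OF less]]
        by (simp add: countability_measure_def)
    qed
  qed
  then show ?thesis
    by (rule that[OF f(1) less])
qed

lemma CH_weak_selection_greaterThan:
  assumes Continuum_Hypothesis
  obtains f where "weak_selection f" "\<And>r. countable (sel_greaterThan f r)"
proof -
  obtain W :: "real \<Rightarrow> real \<Rightarrow> bool" where W: "\<And>x. \<not> W x x"
    "\<And>x y. x \<noteq> y \<Longrightarrow> W x y \<longleftrightarrow> \<not> W y x" "\<And>y. countable {x. W x y}"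
    by (rule CH_well_order[OF assms]) (rule that)
  have "W y x \<longleftrightarrow> \<not> W x y" if "x \<noteq> y" for x y
    using W(2)[of y x] that by blast
  then obtain f where f: "weak_selection f" "sel_less f = (\<lambda>x y. W y x)"
    by (rule weak_selection_of_tournament[of "\<lambda>x y. W y x", OF W(1)])
  show ?thesis
  proof (rule that[OF f(1)])
    show "countable (sel_greaterThan f r)" for r
      using W(3) by (simp add: sel_greaterThan_def f(2))
  qed
qed

section \<open>The equivalences\<close>

theorem theorem2p6:
  shows "(Continuum_Hypothesis \<longleftrightarrow>
            (\<exists>f. weak_selection f \<and> (\<forall>r. countable (sel_lessThan f r))))
       \<and> (Continuum_Hypothesis \<longleftrightarrow>
            (\<exists>f. weak_selection f \<and> (\<forall>r. countable (sel_greaterThan f r))))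
       \<and> (Continuum_Hypothesis \<longleftrightarrow>
            (\<exists>f. weak_selection f \<and> (\<forall>r s. countable (sel_greaterThanAtMost f r s))))
       \<and> (Continuum_Hypothesis \<longleftrightarrow>
            (\<exists>f D. weak_selection f \<and> |D| =o |UNIV :: real set|
                   \<and> (\<forall>r s. countable (sel_greaterThanAtMost f r s \<inter> D))))
       \<and> (Continuum_Hypothesis \<longleftrightarrow>
            (\<exists>f. weak_selection f \<and> sel_outer f = countability_measure))"
  (is "(_ \<longleftrightarrow> ?less) \<and> (_ \<longleftrightarrow> ?greater) \<and> (_ \<longleftrightarrow> ?interval) \<and> (_ \<longleftrightarrow> ?dense) \<and> (_ \<longleftrightarrow> ?outer)")
proof -
  have less: ?less and outer: ?outer if CH: Continuum_Hypothesis
  proof -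
    obtain f where f: "weak_selection f" "\<And>r. countable (sel_lessThan f r)"
      "sel_outer f = countability_measure"
      by (rule CH_weak_selection[OF CH]) (rule that)
    show ?less
      by (intro exI[of _ f] conjI allI f)
    show ?outer
      by (intro exI[of _ f] conjI f)
  qed
  have greater: ?greater if CH: Continuum_Hypothesis
  proof -
    obtain f where f: "weak_selection f" "\<And>r. countable (sel_greaterThan f r)"
      by (rule CH_weak_selection_greaterThan[OF CH]) (rule that)
    show ?greater
      by (intro exI[of _ f] conjI allI f)
  qed
  have less_interval: ?interval if ex: ?less
  proof -
    obtain f where f: "weak_selection f" "\<forall>r. countable (sel_lessThan f r)"
      using ex by (elim exE conjE) (rule that)
    show ?interval
      using f(2) by (intro exI[of _ f] conjI allI f(1) countable_intervals_if_countable_lessThan) simp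
  qed
  have greater_interval: ?interval if ex: ?greater
  proof -
    obtain f where f: "weak_selection f" "\<forall>r. countable (sel_greaterThan f r)"
      using ex by (elim exE conjE) (rule that)
    show ?interval
      using f(2)
      by (intro exI[of _ f] conjI allI f(1) countable_subset[OF sel_greaterThanAtMost_subset_greaterThan]) simp
  qed
  have interval_dense: ?dense if ex: ?interval
  proof -
    obtain f where "weak_selection f" "\<forall>r s. countable (sel_greaterThanAtMost f r s)"
      using ex by (elim exE conjE) (rule that)
    then show ?dense
      by (intro exI[of _ f] exI[of _ UNIV]) (simp add: card_of_refl)
  qed
  have dense: Continuum_Hypothesis if ?dense
    using that by (elim exE conjE) (rule CH_if_countable_intervals_on, assumption+, simp)
  have measure: Continuum_Hypothesis if ?outer
    using that by (elim exE conjE) (rule CH_if_sel_outer_eq_countability_measure)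
  show ?thesis
    using less outer greater less_interval greater_interval interval_dense dense measure
    by argo
qed

end
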